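(* Consider any feasible solution of the MAXBAND constraints. Then for every artery $a\in A$ and every $i\in\{1,\dots,n_a-1\}$, writing $j=i+1$, the integer variable $m_i^a$ in the arterial loop constraint satisfies $$\underline{m_i^a}\le m_i^a\le\overline{m_i^a},$$ where $$\overline{m_i^a}=\left\lfloor 2-\tfrac12(r_{ai}+\overline r_{ai})-\tfrac12(r_{aj}+\overline r_{aj})+\tfrac12(\ell_{ai}+\overline\ell_{ai})+\tfrac12(\ell_{aj}+\overline\ell_{aj})-(\tau_{aj}+\overline\tau_{ai})+\frac{d_i^a}{e_i^aT_1}+\frac{d_i^a}{\overline e_i^aT_1}\right\rfloor,$$ $$\underline{m_i^a}=\left\lceil -2+\tfrac12(r_{ai}+\overline r_{ai})+\tfrac12(r_{aj}+\overline r_{aj})-\tfrac12(\ell_{ai}+\overline\ell_{ai})-\tfrac12(\ell_{aj}+\overline\ell_{aj})-(\tau_{aj}+\overline\tau_{ai})+\frac{d_i^a}{f_i^aT_2}+\frac{d_i^a}{\overline f_i^aT_2}\right\rceil.$$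
   Context: $A$ is a finite set of two-way arteries; artery $a$ has signals $S_{a1},\dots,S_{an_a}$, numbered increasingly in the outbound direction. Barred quantities refer to the inbound direction. Parameters (real numbers): $0<T_1\le T_2$ (bounds on the period length); for each signal, red times $r_{ai},\overline r_{ai}\in[0,1]$, left turn phase times $\ell_{ai},\overline\ell_{ai}\ge0$, and queue-clearance advancements $\tau_{ai},\overline\tau_{ai}$; the red times have the form $r_{ai}=R_{ai}+\overline\ell_{ai}$ and $\overline r_{ai}=R_{ai}+\ell_{ai}$ with $R_{ai}$ the common red time. For each $i=1,\dots,n_a-1$: the distance $d_i^a>0$ between $S_{ai}$ and $S_{a,i+1}$ (the same in both directions), and velocity bounds $0<e_i^a\le f_i^a$ and $0<\overline e_i^a\le\overline f_i^a$. Variables: $z$, $b_a,\overline b_a$, $w_{ai},\overline w_{ai}$, $t_i^a,\overline t_i^a$ (all nonnegative reals), $\delta_{ai},\overline\delta_{ai}\in\{0,1\}$, $m_i^a\in\mathbb Z$. The MAXBAND constraints used here are: (1) $\frac1{T_2}\le z\le\frac1{T_1}$. (2) $w_{ai}+b_a\le 1-r_{ai}$ and $\overline w_{ai}+\overline b_a\le1-\overline r_{ai}$ for all $a\in A$, $i=1,\dots,n_a$. (3) $\frac{d_i^a}{f_i^a}z\le t_i^a\le\frac{d_i^a}{e_i^a}z$ and $\frac{d_i^a}{\overline f_i^a}z\le\overline t_i^a\le\frac{d_i^a}{\overline e_i^a}z$ for all $a\in A$, $i=1,\dots,n_a-1$. (4) Arterial loop constraint: for all $a\in A$, $i=1,\dots,n_a-1$,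 $$(w_{ai}+\overline w_{ai})-(w_{a,i+1}+\overline w_{a,i+1})+(t_i^a+\overline t_i^a)+(\delta_{ai}\ell_{ai}-\overline\delta_{ai}\overline\ell_{ai})-(\delta_{a,i+1}\ell_{a,i+1}-\overline\delta_{a,i+1}\overline\ell_{a,i+1})+(r_{ai}-r_{a,i+1})-(\tau_{a,i+1}+\overline\tau_{ai})=m_i^a.$$ The full model has further constraints (limits on changes of velocity between consecutive segments and network loop constraints); a feasible solution satisfies in particular all those listed. *)

theory Defs
  imports Complex_Main
begin

text \<open>
  Outbound quantities carry the suffix \<open>_out\<close>; their inbound (barred) counterparts carry
  \<open>_in\<close>. Signals of artery \<open>a\<close> are indexed by \<open>1, \<dots>, num_signals P a\<close>, and segment \<open>i\<close> joins
  signals \<open>i\<close> and \<open>i + 1\<close>. Values at other indices, or at \<open>a\<close> outside \<open>arteries P\<close>, are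
  irrelevant.
\<close>

record 'a maxband_data =
  arteries    :: "'a set"
  num_signals :: "'a \<Rightarrow> nat"                   (* n_a *)
  period_min  :: real                           (* T_1 *)
  period_max  :: real                           (* T_2 *)
  common_red  :: "'a \<Rightarrow> nat \<Rightarrow> real"            (* R_ai *)
  red_out     :: "'a \<Rightarrow> nat \<Rightarrow> real"            (* r_ai *)
  red_in      :: "'a \<Rightarrow> nat \<Rightarrow> real"
  left_out    :: "'a \<Rightarrow> nat \<Rightarrow> real"            (* l_ai, left turn phase *)
  left_in     :: "'a \<Rightarrow> nat \<Rightarrow> real"
  queue_out   :: "'a \<Rightarrow> nat \<Rightarrow> real"            (* tau_ai, queue clearance *)
  queue_in    :: "'a \<Rightarrow> nat \<Rightarrow> real"
  dist_seg    :: "'a \<Rightarrow> nat \<Rightarrow> real"            (* d_i^a *)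
  vmin_out    :: "'a \<Rightarrow> nat \<Rightarrow> real"            (* e_i^a *)
  vmax_out    :: "'a \<Rightarrow> nat \<Rightarrow> real"            (* f_i^a *)
  vmin_in     :: "'a \<Rightarrow> nat \<Rightarrow> real"
  vmax_in     :: "'a \<Rightarrow> nat \<Rightarrow> real"

definition valid_data :: "'a maxband_data \<Rightarrow> bool" where
  "valid_data P \<longleftrightarrow>
     finite (arteries P) \<and>
     0 < period_min P \<and> period_min P \<le> period_max P \<and>
     (\<forall>a\<in>arteries P. \<forall>i\<in>{1..num_signals P a}.
        red_out P a i \<in> {0..1} \<and> red_in P a i \<in> {0..1} \<and>
        0 \<le> left_out P a i \<and> 0 \<le> left_in P a i \<and>
        red_out P a i = common_red P a i + left_in P a i \<and>
        red_in P a i = common_red P a i + left_out P a i) \<and>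
     (\<forall>a\<in>arteries P. \<forall>i\<in>{1..<num_signals P a}.
        0 < dist_seg P a i \<and>
        0 < vmin_out P a i \<and> vmin_out P a i \<le> vmax_out P a i \<and>
        0 < vmin_in P a i \<and> vmin_in P a i \<le> vmax_in P a i)"

record 'a maxband_vars =
  freq        :: real                           (* z, reciprocal of the period *)
  band_out    :: "'a \<Rightarrow> real"                   (* b_a *)
  band_in     :: "'a \<Rightarrow> real"
  w_out       :: "'a \<Rightarrow> nat \<Rightarrow> real"            (* w_ai *)
  w_in        :: "'a \<Rightarrow> nat \<Rightarrow> real"
  time_out    :: "'a \<Rightarrow> nat \<Rightarrow> real"            (* t_i^a *)
  time_in     :: "'a \<Rightarrow> nat \<Rightarrow> real"
  delta_out   :: "'a \<Rightarrow> nat \<Rightarrow> real"            (* delta_ai *)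
  delta_in    :: "'a \<Rightarrow> nat \<Rightarrow> real"
  loop_int    :: "'a \<Rightarrow> nat \<Rightarrow> int"             (* m_i^a *)

definition variable_domains :: "'a maxband_data \<Rightarrow> 'a maxband_vars \<Rightarrow> bool" where
  "variable_domains P x \<longleftrightarrow>
     0 \<le> freq x \<and>
     (\<forall>a\<in>arteries P. 0 \<le> band_out x a \<and> 0 \<le> band_in x a) \<and>
     (\<forall>a\<in>arteries P. \<forall>i\<in>{1..num_signals P a}.
        0 \<le> w_out x a i \<and> 0 \<le> w_in x a i \<and>
        delta_out x a i \<in> {0, 1} \<and> delta_in x a i \<in> {0, 1}) \<and>
     (\<forall>a\<in>arteries P. \<forall>i\<in>{1..<num_signals P a}.
        0 \<le> time_out x a i \<and> 0 \<le> time_in x a i)"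

definition period_constraint :: "'a maxband_data \<Rightarrow> 'a maxband_vars \<Rightarrow> bool" where
  "period_constraint P x \<longleftrightarrow> 1 / period_max P \<le> freq x \<and> freq x \<le> 1 / period_min P"

definition band_constraint :: "'a maxband_data \<Rightarrow> 'a maxband_vars \<Rightarrow> bool" where
  "band_constraint P x \<longleftrightarrow>
     (\<forall>a\<in>arteries P. \<forall>i\<in>{1..num_signals P a}.
        w_out x a i + band_out x a \<le> 1 - red_out P a i \<and>
        w_in x a i + band_in x a \<le> 1 - red_in P a i)"

definition travel_time_constraint :: "'a maxband_data \<Rightarrow> 'a maxband_vars \<Rightarrow> bool" where
  "travel_time_constraint P x \<longleftrightarrow>
     (\<forall>a\<in>arteries P. \<forall>i\<in>{1..<num_signals P a}.
        dist_seg P a i / vmax_out P a i * freq x \<le> time_out x a i \<and>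
        time_out x a i \<le> dist_seg P a i / vmin_out P a i * freq x \<and>
        dist_seg P a i / vmax_in P a i * freq x \<le> time_in x a i \<and>
        time_in x a i \<le> dist_seg P a i / vmin_in P a i * freq x)"

definition arterial_loop_constraint :: "'a maxband_data \<Rightarrow> 'a maxband_vars \<Rightarrow> bool" where
  "arterial_loop_constraint P x \<longleftrightarrow>
     (\<forall>a\<in>arteries P. \<forall>i\<in>{1..<num_signals P a}.
        (w_out x a i + w_in x a i) - (w_out x a (i + 1) + w_in x a (i + 1))
        + (time_out x a i + time_in x a i)
        + (delta_out x a i * left_out P a i - delta_in x a i * left_in P a i)
        - (delta_out x a (i + 1) * left_out P a (i + 1)
             - delta_in x a (i + 1) * left_in P a (i + 1))
        + (red_out P a i - red_out P a (i + 1))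
        - (queue_out P a (i + 1) + queue_in P a i)
        = of_int (loop_int x a i))"

text \<open>
  The full MAXBAND model additionally limits changes of velocity between consecutive segments
  and imposes network loop constraints. Leaving these out makes the set of feasible solutions
  larger, so statements about all feasible solutions also cover the full model.
\<close>

definition feasible :: "'a maxband_data \<Rightarrow> 'a maxband_vars \<Rightarrow> bool" where
  "feasible P x \<longleftrightarrow>
     variable_domains P x \<and> period_constraint P x \<and> band_constraint P x \<and>
     travel_time_constraint P x \<and> arterial_loop_constraint P x"

definition loop_int_upper :: "'a maxband_data \<Rightarrow> 'a \<Rightarrow> nat \<Rightarrow> int" where
  "loop_int_upper P a i = (let j = i + 1 in
     \<lfloor>2 - 1/2 * (red_out P a i + red_in P a i) - 1/2 * (red_out P a j + red_in P a j)
      + 1/2 * (left_out P a i + left_in P a i) + 1/2 * (left_out P a j + left_in P a j)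
      - (queue_out P a j + queue_in P a i)
      + dist_seg P a i / (vmin_out P a i * period_min P)
      + dist_seg P a i / (vmin_in P a i * period_min P)\<rfloor>)"

definition loop_int_lower :: "'a maxband_data \<Rightarrow> 'a \<Rightarrow> nat \<Rightarrow> int" where
  "loop_int_lower P a i = (let j = i + 1 in
     \<lceil>- 2 + 1/2 * (red_out P a i + red_in P a i) + 1/2 * (red_out P a j + red_in P a j)
      - 1/2 * (left_out P a i + left_in P a i) - 1/2 * (left_out P a j + left_in P a j)
      - (queue_out P a j + queue_in P a i)
      + dist_seg P a i / (vmax_out P a i * period_max P)
      + dist_seg P a i / (vmax_in P a i * period_max P)\<rceil>)"

end

(* Since r = R + l_in and r_in = R + l_out at each signal, (r + r_in)/2 - (l_out + l_in)/2 is the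
   common red time R, so the bounds to prove are +-(2 - R_i - R_j) plus the queue and travel
   terms. They follow by bounding the terms of the loop constraint one at a time, using
   0 <= w <= 1 - r and 0 <= delta * l <= l. *)
theory Submission
  imports Defs
begin

theorem mainTheorem2:
  fixes P :: "'a maxband_data" and x :: "'a maxband_vars"
  assumes "valid_data P"
    and "feasible P x"
  shows "\<forall>a\<in>arteries P. \<forall>i\<in>{1..<num_signals P a}.
           loop_int_lower P a i \<le> loop_int x a i \<and> loop_int x a i \<le> loop_int_upper P a i"
proof (intro ballI)
  fix a i
  assume a: "a \<in> arteries P" and i: "i \<in> {1..<num_signals P a}"
  note valid = assms(1)[unfolded valid_data_def]
  \<comment> \<open>The products \<open>delta * l\<close> are bounded as single quantities, so that
    the final estimate is linear.\<close>
  have signal: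
    "red_out P a k = common_red P a k + left_in P a k \<and>
     red_in P a k = common_red P a k + left_out P a k \<and>
     0 \<le> w_out x a k \<and> w_out x a k \<le> 1 - red_out P a k \<and>
     0 \<le> w_in x a k \<and> w_in x a k \<le> 1 - red_in P a k \<and>
     0 \<le> delta_out x a k * left_out P a k \<and> delta_out x a k * left_out P a k \<le> left_out P a k \<and>
     0 \<le> delta_in x a k * left_in P a k \<and> delta_in x a k * left_in P a k \<le> left_in P a k"
    if k: "k \<in> {1..num_signals P a}" for k
  proof -
    have band: "w_out x a k + band_out x a \<le> 1 - red_out P a k"
      "w_in x a k + band_in x a \<le> 1 - red_in P a k"
      using assms(2) a k unfolding feasible_def band_constraint_def by blast+
    have dom: "0 \<le> band_out x a" "0 \<le> band_in x a" "0 \<le> w_out x a k" "0 \<le> w_in x a k"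
      "delta_out x a k \<in> {0, 1}" "delta_in x a k \<in> {0, 1}"
      using assms(2) a k unfolding feasible_def variable_domains_def by blast+
    have "0 \<le> left_out P a k" "0 \<le> left_in P a k"
      "red_out P a k = common_red P a k + left_in P a k"
      "red_in P a k = common_red P a k + left_out P a k"
      using valid a k by blast+
    \<comment> \<open>Dropping the nonnegative bandwidth leaves \<open>w \<le> 1 - r\<close>; as
      delta is 0 or 1, \<open>delta * l\<close> is 0 or \<open>l\<close>.\<close>
    with band dom show ?thesis by auto
  qed
  have si: "i \<in> {1..num_signals P a}" and sj: "i + 1 \<in> {1..num_signals P a}"
    using i by auto
  have loop: "(w_out x a i + w_in x a i) - (w_out x a (i + 1) + w_in x a (i + 1))
        + (time_out x a i + time_in x a i)
        + (delta_out x a i * left_out P a i - delta_in x a i * left_in P a i)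
        - (delta_out x a (i + 1) * left_out P a (i + 1)
             - delta_in x a (i + 1) * left_in P a (i + 1))
        + (red_out P a i - red_out P a (i + 1))
        - (queue_out P a (i + 1) + queue_in P a i)
        = of_int (loop_int x a i)"
    using assms(2) a i unfolding feasible_def arterial_loop_constraint_def by blast
  have freq: "1 / period_max P \<le> freq x" "freq x \<le> 1 / period_min P"
    using assms(2) unfolding feasible_def period_constraint_def by auto
  have time: "dist_seg P a i / vmax_out P a i * freq x \<le> time_out x a i"
      "time_out x a i \<le> dist_seg P a i / vmin_out P a i * freq x"
      "dist_seg P a i / vmax_in P a i * freq x \<le> time_in x a i"
      "time_in x a i \<le> dist_seg P a i / vmin_in P a i * freq x"
    using assms(2) a i unfolding feasible_def travel_time_constraint_def by blast+
  have seg: "0 < dist_seg P a i" "0 < vmin_out P a i" "vmin_out P a i \<le> vmax_out P a i"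
      "0 < vmin_in P a i" "vmin_in P a i \<le> vmax_in P a i"
    using valid a i by blast+
  \<comment> \<open>Scaling the bounds on \<open>freq x\<close> by \<open>d / v > 0\<close> removes
    the variable: the travel time, counted in periods, is least at top speed with the longest period
    and greatest at lowest speed with the shortest.\<close>
  have lower: "d / (v * period_max P) \<le> t" if "d / v * freq x \<le> t" "0 < d" "0 < v" for d v t
    using mult_left_mono[OF freq(1), of "d / v"] that by simp
  have upper: "t \<le> d / (v * period_min P)" if "t \<le> d / v * freq x" "0 < d" "0 < v" for d v t
    using mult_left_mono[OF freq(2), of "d / v"] that by simp
  have times: "dist_seg P a i / (vmax_out P a i * period_max P) \<le> time_out x a i"
      "time_out x a i \<le> dist_seg P a i / (vmin_out P a i * period_min P)"
      "dist_seg P a i / (vmax_in P a i * period_max P) \<le> time_in x a i"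
      "time_in x a i \<le> dist_seg P a i / (vmin_in P a i * period_min P)"
    using seg by (auto intro!: lower upper time)
  show "loop_int_lower P a i \<le> loop_int x a i \<and> loop_int x a i \<le> loop_int_upper P a i"
    \<comment> \<open>As \<open>loop_int x a i\<close> is an integer, floor and ceiling drop out.
      With j = i + 1, the upper estimate takes the w terms at i maximal and those at j zero:
      \<open>red_out\<close> at i cancels, \<open>- red_in + left_out\<close> at i is -R_i, and
      \<open>- red_out + left_in\<close> at j is -R_j. The lower estimate exchanges i and j in the w
      terms, leaving \<open>red_out - left_in\<close> at i and \<open>red_in - left_out\<close> at
      j.\<close>
    unfolding loop_int_lower_def loop_int_upper_def Let_def ceiling_le_iff le_floor_iff
    using signal[OF si] signal[OF sj] loop times by argo
qed

end
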